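(* Let $(V,E,<)$ be a nonempty wellordered connected graph, let $\prec$ be its algorithmic traversal, let $p^\star$ be the traversal least neighbor function, and let $E^\star\subseteq E$ be the symmetrization of the graph of $p^\star$, i.e., the edge relation connecting each non-minimal $v$ to $p^\star(v)$. Then the algorithmic traversal $\prec^\star$ obtained by deterministically searching $(V,E^\star,<)$ is identical to $\prec$.
   Context: A wellordered connected graph $(V,E,<)$ is a connected undirected graph $(V,E)$ (possibly infinite) together with a wellordering $<$ of $V$. Deterministic graph search on $(V,E,<)$ defines sets $S_\alpha\subseteq V$ by transfinite recursion: $S_0=\emptyset$; $S_1=\{v_0\}$, where $v_0$ is the $<$-least element of $V$; for $\beta\ge 1$, $S_{\beta+1}$ is obtained from $S_\beta$ by adding the $<$-least element of $\{v\in V\setminus S_\beta:\exists w\in S_\beta\ E(w,v)\}$ if this set is nonempty, and $S_{\beta+1}=S_\beta$ otherwise; and $S_\alpha=\bigcup_{\beta<\alpha}S_\beta$ at limit $\alpha$. Every vertex eventually enters some $S_\alpha$. The algorithmic traversal is the wellordering $\prec$ of $V$ given by $v\prec w$ iff the least $\alpha$ with $v\in S_\alpha$ is less than the least $\alpha$ with $w\in S_\alpha$. The traversal least neighbor function $p^\star$ takes each vertex $v$ other than the least element of $V$ to its $\prec$-least $E$-neighbor, and is undefined on the least element. The graph $(V,E^\star)$ is a spanning tree of $(V,E)$, hence connected. *)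

theory Defs
  imports Main
begin

section \<open>Ordinals indexing the search\<close>

text \<open>
  HOL has no type of all ordinals.  The stages of a search on vertices of type \<open>'a\<close> are indexed by
  the ordinals below the initial ordinal of cardinality \<open>2 ^ max |'a| \<aleph>\<^sub>0\<close>: the order
  \<open>card_of UNIV\<close> is a wellorder of minimal length on its field.  This initial segment has no
  greatest element and, by Cantor's theorem, does not inject into the vertices (lemma
  \<open>no_inj_ordinal\<close>).  A search adds a new vertex at each successor step until it stops, so it
  becomes constant within this segment, and later ordinals contribute nothing.
\<close>

typedef 'a ordinal = "UNIV :: ('a + nat) set set"
  by simp

instantiation ordinal :: (type) wellorder
begin

definition less_eq_ordinal_def:
  "(\<alpha> :: 'a ordinal) \<le> \<beta> \<longleftrightarrow> (Rep_ordinal \<alpha>, Rep_ordinal \<beta>) \<in> card_of (UNIV :: ('a + nat) set set)"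

definition less_ordinal_def:
  "(\<alpha> :: 'a ordinal) < \<beta> \<longleftrightarrow> \<alpha> \<le> \<beta> \<and> \<alpha> \<noteq> \<beta>"

instance
proof
  let ?r = "card_of (UNIV :: ('a + nat) set set)"
  have wo: "well_order_on UNIV ?r"
    by (rule card_of_well_order_on)
  then have lin: "refl ?r" "trans ?r" "antisym ?r" "total ?r" and wf: "wf (?r - Id)"
    by (auto simp: well_order_on_def linear_order_on_def partial_order_on_def preorder_on_def)
  fix x y z :: "'a ordinal"
  show le_refl: "x \<le> x"
    using lin(1) by (simp add: less_eq_ordinal_def refl_on_def)
  show le_trans: "x \<le> y \<Longrightarrow> y \<le> z \<Longrightarrow> x \<le> z"
    using lin(2) unfolding less_eq_ordinal_def by (meson transD)
  show anti: "x \<le> y \<Longrightarrow> y \<le> x \<Longrightarrow> x = y"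
    using lin(3) unfolding less_eq_ordinal_def by (meson Rep_ordinal_inject antisymD)
  show "x < y \<longleftrightarrow> x \<le> y \<and> \<not> y \<le> x"
    using anti le_refl unfolding less_ordinal_def
    by (metis Rep_ordinal_inject antisymD less_eq_ordinal_def lin(3))
  show "x \<le> y \<or> y \<le> x"
    using lin(4) le_refl unfolding less_eq_ordinal_def
    by (metis UNIV_I Rep_ordinal_inject total_on_def)
  fix P :: "'a ordinal \<Rightarrow> bool" and a
  assume step: "\<And>x. (\<And>y. y < x \<Longrightarrow> P y) \<Longrightarrow> P x"
  have "wf (inv_image (?r - Id) Rep_ordinal)"
    using wf by (rule wf_inv_image)
  moreover have "(y, x) \<in> inv_image (?r - Id) Rep_ordinal \<longleftrightarrow> y < x" for x y :: "'a ordinal"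
    by (auto simp: inv_image_def less_ordinal_def less_eq_ordinal_def Rep_ordinal_inject)
  ultimately show "P a"
    using step by (metis wf_induct_rule)
qed

end

instantiation ordinal :: (type) zero
begin

definition zero_ordinal_def:
  "(0 :: 'a ordinal) = (LEAST \<alpha>. True)"

instance ..

end

definition osuc :: "'a ordinal \<Rightarrow> 'a ordinal" where
  "osuc \<beta> = (LEAST \<gamma>. \<beta> < \<gamma>)"

lemma zero_le_ordinal [simp]: "0 \<le> (\<alpha> :: 'a ordinal)"
  by (simp add: zero_ordinal_def Least_le)

lemma ordinal_no_max: "\<exists>\<gamma>. (\<beta> :: 'a ordinal) < \<gamma>"
proof -
  have "infinite (UNIV :: ('a + nat) set set)"
    by (simp add: Finite_Set.finite_set)
  then obtain b where "b \<noteq> Rep_ordinal \<beta>"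
    "(Rep_ordinal \<beta>, b) \<in> card_of (UNIV :: ('a + nat) set set)"
    using infinite_Card_order_limit[OF card_of_Card_order[of "UNIV :: ('a + nat) set set"],
        of "Rep_ordinal \<beta>"]
    by (metis Field_card_of UNIV_I)
  then have "\<beta> < Abs_ordinal b"
    by (auto simp: less_ordinal_def less_eq_ordinal_def Abs_ordinal_inverse Rep_ordinal_inverse)
  then show ?thesis ..
qed

lemma less_osuc [simp]: "\<beta> < osuc \<beta>"
  unfolding osuc_def using ordinal_no_max by (rule LeastI_ex)

lemma osuc_le_iff: "osuc \<beta> \<le> \<gamma> \<longleftrightarrow> \<beta> < \<gamma>"
  using less_osuc[of \<beta>] unfolding osuc_def by (meson Least_le less_le_trans)

lemma osuc_inject [simp]: "osuc \<beta> = osuc \<gamma> \<longleftrightarrow> \<beta> = \<gamma>"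
  by (metis less_osuc linorder_neqE not_le osuc_le_iff)

lemma osuc_neq_zero [simp]: "osuc \<beta> \<noteq> 0"
  by (metis less_osuc not_le zero_le_ordinal)

lemma no_inj_ordinal: "\<not> inj (f :: 'a ordinal \<Rightarrow> 'a)"
proof
  assume "inj f"
  moreover have "inj (\<lambda>X :: 'a set. Abs_ordinal (Inl ` X :: ('a + nat) set))"
    by (auto simp: inj_def Abs_ordinal_inject)
  ultimately have "inj (f \<circ> (\<lambda>X :: 'a set. Abs_ordinal (Inl ` X)))"
    by (rule inj_compose)
  then show False
    using Cantors_theorem[of "UNIV :: 'a set"]
    by (metis Pow_UNIV inj_imp_surj_inv)
qed


section \<open>Wellordered connected graphs\<close>

text \<open>Strict orders are sets of pairs: \<open>(v, w) \<in> lt\<close> stands for \<open>v < w\<close>.\<close>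

definition strict_well_order_on :: "'a set \<Rightarrow> 'a rel \<Rightarrow> bool" where
  "strict_well_order_on V lt \<longleftrightarrow> lt \<subseteq> V \<times> V \<and> strict_linear_order_on V lt \<and> wf lt"

definition least_in :: "'a rel \<Rightarrow> 'a set \<Rightarrow> 'a" where
  "least_in lt A = (THE a. a \<in> A \<and> (\<forall>b\<in>A. b \<noteq> a \<longrightarrow> (a, b) \<in> lt))"

text \<open>Loops are not excluded; they affect neither the search nor the definitions below.\<close>

definition connected_graph :: "'a set \<Rightarrow> 'a rel \<Rightarrow> bool" where
  "connected_graph V E \<longleftrightarrow> E \<subseteq> V \<times> V \<and> sym E \<and> (\<forall>v\<in>V. \<forall>w\<in>V. (v, w) \<in> E\<^sup>*)"

definition wellordered_connected_graph :: "'a set \<Rightarrow> 'a rel \<Rightarrow> 'a rel \<Rightarrow> bool" where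
  "wellordered_connected_graph V E lt \<longleftrightarrow> connected_graph V E \<and> strict_well_order_on V lt"


section \<open>Deterministic graph search\<close>

definition search_step :: "'a set \<Rightarrow> 'a rel \<Rightarrow> 'a rel \<Rightarrow> 'a set \<Rightarrow> 'a set" where
  "search_step V E lt S =
     (let N = {v \<in> V - S. \<exists>w\<in>S. (w, v) \<in> E}
      in if N = {} then S else insert (least_in lt N) S)"

text \<open>The four defining clauses are \<open>stage_zero\<close>, \<open>stage_one\<close>, \<open>stage_osuc\<close>, \<open>stage_limit\<close> below.\<close>

function stage :: "'a set \<Rightarrow> 'a rel \<Rightarrow> 'a rel \<Rightarrow> 'a ordinal \<Rightarrow> 'a set" where
  "stage V E lt \<alpha> =
     (if \<alpha> = 0 then {}
      else if \<alpha> = osuc 0 then {least_in lt V}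
      else if \<exists>\<beta>. \<alpha> = osuc \<beta> then search_step V E lt (stage V E lt (THE \<beta>. \<alpha> = osuc \<beta>))
      else (\<Union>\<beta>\<in>{\<beta>. \<beta> < \<alpha>}. stage V E lt \<beta>))"
  by auto
termination
  by (relation "inv_image {(\<beta>, \<alpha>). \<beta> < \<alpha>} (\<lambda>(V, E, lt, \<alpha>). \<alpha>)") (auto intro: wf)

declare stage.simps [simp del]

lemma stage_zero: "stage V E lt 0 = {}"
  by (simp add: stage.simps)

lemma stage_one: "stage V E lt (osuc 0) = {least_in lt V}"
  by (simp add: stage.simps)

lemma stage_osuc:
  assumes "osuc 0 \<le> \<beta>"
  shows "stage V E lt (osuc \<beta>) = search_step V E lt (stage V E lt \<beta>)"
  using assms by (subst stage.simps) (auto simp: osuc_le_iff)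

lemma stage_limit:
  assumes "\<alpha> \<noteq> 0" and "\<And>\<beta>. \<alpha> \<noteq> osuc \<beta>"
  shows "stage V E lt \<alpha> = (\<Union>\<beta>\<in>{\<beta>. \<beta> < \<alpha>}. stage V E lt \<beta>)"
  using assms by (subst stage.simps) auto

definition algorithmic_traversal :: "'a set \<Rightarrow> 'a rel \<Rightarrow> 'a rel \<Rightarrow> 'a rel" where
  "algorithmic_traversal V E lt =
     {(v, w). v \<in> V \<and> w \<in> V \<and>
        (LEAST \<alpha>. v \<in> stage V E lt \<alpha>) < (LEAST \<alpha>. w \<in> stage V E lt \<alpha>)}"


section \<open>The traversal least neighbor function\<close>

definition traversal_least_neighbor :: "'a set \<Rightarrow> 'a rel \<Rightarrow> 'a rel \<Rightarrow> 'a \<rightharpoonup> 'a" where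
  "traversal_least_neighbor V E lt v =
     (if v \<in> V \<and> v \<noteq> least_in lt V
      then Some (least_in (algorithmic_traversal V E lt) {w. (v, w) \<in> E})
      else None)"

definition traversal_edges :: "'a set \<Rightarrow> 'a rel \<Rightarrow> 'a rel \<Rightarrow> 'a rel" where
  "traversal_edges V E lt =
     Map.graph (traversal_least_neighbor V E lt) \<union> (Map.graph (traversal_least_neighbor V E lt))\<inverse>"

end

theory Submission
  imports Defs
begin

text \<open>
  The two searches agree stage by stage, because at each stage \<open>S \<noteq> \<emptyset>\<close> the two graphs have the same
  frontier, that is, the same vertices outside \<open>S\<close> with a neighbor in \<open>S\<close>
  (\<open>frontier_traversal_edges\<close>).  As \<open>p\<^sup>\<star>\<close> picks a neighbor, \<open>E\<^sup>\<star> \<subseteq> E\<close>, which gives one inclusion.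
  For the other, let \<open>v \<notin> S\<close> have an \<open>E\<close>-neighbor \<open>w \<in> S\<close>.  The least neighbor \<open>p\<^sup>\<star> v\<close> entered the
  search no later than \<open>w\<close>; stages grow, so \<open>p\<^sup>\<star> v \<in> S\<close>, and \<open>v\<close> has an \<open>E\<^sup>\<star>\<close>-neighbor in \<open>S\<close>.

  For \<open>p\<^sup>\<star> v\<close> to be a neighbor of \<open>v\<close> at all, the traversal must be a wellorder of \<open>V\<close>.  This
  rests on two facts: every vertex enters (\<open>every_vertex_enters\<close>, by connectedness and because a
  search that never stops would inject the ordinals into the vertices), and no two vertices enter
  at the same stage (\<open>same_entry_imp_eq\<close>).
\<close>

section \<open>Least elements and ordinals\<close>

lemma least_in_strict_well_order:
  assumes "strict_well_order_on V lt" and "A \<subseteq> V" and "A \<noteq> {}"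
  shows least_in_mem: "least_in lt A \<in> A"
    and least_in_less: "b \<in> A \<Longrightarrow> b \<noteq> least_in lt A \<Longrightarrow> (least_in lt A, b) \<in> lt"
proof -
  have wf: "wf lt" and tot: "total_on V lt"
    using assms(1) by (auto simp: strict_well_order_on_def strict_linear_order_on_def)
  obtain a where a: "a \<in> A" "\<And>y. (y, a) \<in> lt \<Longrightarrow> y \<notin> A"
    using wf assms(3) by (metis wfE_min ex_in_conv)
  have "\<forall>b\<in>A. b \<noteq> a \<longrightarrow> (a, b) \<in> lt"
    using a tot assms(2) unfolding total_on_def by blast
  with a have "least_in lt A = a"
    unfolding least_in_def by (intro the_equality) auto
  with a \<open>\<forall>b\<in>A. b \<noteq> a \<longrightarrow> (a, b) \<in> lt\<close>
  show "least_in lt A \<in> A"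
    and "b \<in> A \<Longrightarrow> b \<noteq> least_in lt A \<Longrightarrow> (least_in lt A, b) \<in> lt"
    by auto
qed

lemma less_osuc_iff: "\<alpha> < osuc \<beta> \<longleftrightarrow> \<alpha> \<le> \<beta>"
  by (metis not_le osuc_le_iff)

lemma one_le_ordinal_iff: "osuc 0 \<le> \<beta> \<longleftrightarrow> \<beta> \<noteq> 0"
  by (metis neq_iff not_le osuc_le_iff zero_le_ordinal)

section \<open>Growth of the search\<close>

lemma stage_subset_stage_osuc: "stage V E lt \<beta> \<subseteq> stage V E lt (osuc \<beta>)"
proof (cases "\<beta> = 0")
  case False
  then show ?thesis
    by (auto simp: stage_osuc one_le_ordinal_iff search_step_def Let_def)
qed (simp add: stage_zero)

lemma stage_mono: "\<alpha> \<le> \<beta> \<Longrightarrow> stage V E lt \<alpha> \<subseteq> stage V E lt \<beta>"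
proof (induction \<beta> rule: less_induct)
  case (less \<beta>)
  consider "\<alpha> = \<beta>" | \<gamma> where "\<beta> = osuc \<gamma>" "\<alpha> \<le> \<gamma>" | "\<alpha> < \<beta>" "\<forall>\<gamma>. \<beta> \<noteq> osuc \<gamma>"
    using less.prems by (metis less_osuc_iff order_le_less)
  then show ?case
  proof cases
    case (2 \<gamma>)
    then show ?thesis
      using less.IH[of \<gamma>] stage_subset_stage_osuc[of V E lt \<gamma>] by auto
  next
    case 3
    then have "\<beta> \<noteq> 0"
      by (metis not_le zero_le_ordinal)
    with 3 show ?thesis
      by (subst (2) stage_limit) auto
  qed simp
qed

abbreviation entry :: "'a set \<Rightarrow> 'a rel \<Rightarrow> 'a rel \<Rightarrow> 'a \<Rightarrow> 'a ordinal" where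
  "entry V E lt v \<equiv> (LEAST \<alpha>. v \<in> stage V E lt \<alpha>)"

lemma mem_stage_iff_entry_le:
  assumes "v \<in> stage V E lt \<gamma>"
  shows "v \<in> stage V E lt \<alpha> \<longleftrightarrow> entry V E lt v \<le> \<alpha>"
  using LeastI[of "\<lambda>\<alpha>. v \<in> stage V E lt \<alpha>", OF assms] stage_mono[of "entry V E lt v" \<alpha> V E lt]
  by (auto intro: Least_le)

text \<open>A limit stage only collects the earlier ones.\<close>

lemma entry_is_successor:
  assumes "v \<in> stage V E lt \<gamma>"
  obtains \<beta> where "entry V E lt v = osuc \<beta>" and "v \<notin> stage V E lt \<beta>"
proof -
  let ?\<alpha> = "entry V E lt v"
  have mem: "v \<in> stage V E lt ?\<alpha>"
    using mem_stage_iff_entry_le[OF assms] by blast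
  have new: "v \<notin> stage V E lt \<beta>" if "\<beta> < ?\<alpha>" for \<beta>
    using that not_less_Least by blast
  have "\<exists>\<beta>. ?\<alpha> = osuc \<beta>"
  proof (rule ccontr)
    assume "\<nexists>\<beta>. ?\<alpha> = osuc \<beta>"
    moreover have "?\<alpha> \<noteq> 0"
      using mem stage_zero by (metis empty_iff)
    ultimately have "stage V E lt ?\<alpha> = (\<Union>\<beta>\<in>{\<beta>. \<beta> < ?\<alpha>}. stage V E lt \<beta>)"
      by (intro stage_limit) auto
    with mem new show False
      by blast
  qed
  with new that show thesis
    by (metis less_osuc)
qed

text \<open>Entry stages are successors, and a successor step adds at most one vertex.\<close>

lemma same_entry_imp_eq:
  assumes v: "v \<in> stage V E lt \<gamma>" and w: "w \<in> stage V E lt \<delta>"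
    and eq: "entry V E lt v = entry V E lt w"
  shows "v = w"
proof -
  obtain \<beta> where \<beta>: "entry V E lt v = osuc \<beta>" "v \<notin> stage V E lt \<beta>"
    using v by (rule entry_is_successor)
  have new: "w \<notin> stage V E lt \<beta>"
    using \<beta> eq mem_stage_iff_entry_le[OF w, of \<beta>] by (simp add: osuc_le_iff)
  have "v \<in> stage V E lt (osuc \<beta>)" "w \<in> stage V E lt (osuc \<beta>)"
    using mem_stage_iff_entry_le[OF v, of "osuc \<beta>"] mem_stage_iff_entry_le[OF w, of "osuc \<beta>"] \<beta> eq
    by auto
  with \<beta>(2) new show ?thesis
    by (cases "\<beta> = 0")
      (auto simp: stage_one stage_osuc one_le_ordinal_iff search_step_def Let_def split: if_splits)
qed

text \<open>
  If every step added a vertex, then the vertices added at different steps would be different, and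
  the ordinals would inject into the vertices.
\<close>

lemma search_stops: "\<exists>\<gamma>. stage V E lt (osuc \<gamma>) = stage V E lt \<gamma>"
proof (rule ccontr)
  assume growing: "\<not> ?thesis"
  have "\<exists>v. v \<in> stage V E lt (osuc \<gamma>) \<and> v \<notin> stage V E lt \<gamma>" for \<gamma>
    using growing stage_subset_stage_osuc[of V E lt \<gamma>] by auto
  then obtain f where f: "f \<gamma> \<in> stage V E lt (osuc \<gamma>)" "f \<gamma> \<notin> stage V E lt \<gamma>" for \<gamma>
    by metis
  have "f \<alpha> \<noteq> f \<beta>" if "\<alpha> < \<beta>" for \<alpha> \<beta>
    using f[of \<alpha>] f[of \<beta>] stage_mono[of "osuc \<alpha>" \<beta> V E lt] that by (auto simp: osuc_le_iff)
  then have "inj f"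
    by (metis injI linorder_neqE)
  then show False
    using no_inj_ordinal by blast
qed

section \<open>The traversal of a connected graph is a wellorder\<close>

text \<open>
  When the search stops, its last stage has an empty frontier; being closed under edges and
  containing the least vertex, it is everything.
\<close>

lemma every_vertex_enters:
  assumes G: "wellordered_connected_graph V E lt" and v: "v \<in> V"
  shows "\<exists>\<gamma>. v \<in> stage V E lt \<gamma>"
proof -
  have wo: "strict_well_order_on V lt" and EV: "E \<subseteq> V \<times> V"
    and conn: "\<forall>v\<in>V. \<forall>w\<in>V. (v, w) \<in> E\<^sup>*"
    using G by (auto simp: wellordered_connected_graph_def connected_graph_def)
  obtain \<gamma> where \<gamma>: "stage V E lt (osuc \<gamma>) = stage V E lt \<gamma>"
    using search_stops[of V E lt] by (elim exE)
  let ?S = "stage V E lt \<gamma>" and ?v0 = "least_in lt V"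
  have "\<gamma> \<noteq> 0"
    using \<gamma> stage_one[of V E lt] stage_zero[of V E lt] by auto
  then have ge1: "osuc 0 \<le> \<gamma>"
    by (simp add: one_le_ordinal_iff)
  let ?N = "{x \<in> V - ?S. \<exists>w\<in>?S. (w, x) \<in> E}"
  have "?N = {}"
  proof (rule ccontr)
    assume "?N \<noteq> {}"
    then have "least_in lt ?N \<in> ?N"
      by (intro least_in_mem[OF wo]) auto
    moreover have "search_step V E lt ?S = insert (least_in lt ?N) ?S"
      using \<open>?N \<noteq> {}\<close> by (simp only: search_step_def Let_def if_False)
    then have "?S = insert (least_in lt ?N) ?S"
      using \<gamma> stage_osuc[OF ge1, of V E lt] by (simp only:)
    then have "least_in lt ?N \<in> ?S"
      by (rule equalityD2[THEN subsetD]) (rule insertI1)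
    ultimately show False
      by blast
  qed
  then have closed: "x \<in> ?S" if "w \<in> ?S" "(w, x) \<in> E" for w x
    using that EV by blast
  have "?v0 \<in> V"
    using least_in_mem[OF wo] v by blast
  then have "(?v0, v) \<in> E\<^sup>*"
    using conn v by blast
  then have "v \<in> ?S"
  proof (induction rule: rtrancl_induct)
    case base
    then show ?case
      using stage_mono[OF ge1, of V E lt] by (simp add: stage_one)
  qed (use closed in blast)
  then show ?thesis ..
qed

lemma algorithmic_traversal_well_order:
  assumes "wellordered_connected_graph V E lt"
  shows "strict_well_order_on V (algorithmic_traversal V E lt)"
proof -
  have "algorithmic_traversal V E lt \<subseteq> inv_image {(\<beta>, \<alpha>). \<beta> < \<alpha>} (entry V E lt)"
    by (auto simp: algorithmic_traversal_def)
  then have "wf (algorithmic_traversal V E lt)"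
    using wf_subset wf_inv_image wf by blast
  moreover have "total_on V (algorithmic_traversal V E lt)"
  proof (intro total_onI)
    fix v w
    assume vw: "v \<in> V" "w \<in> V" "v \<noteq> w"
    then have "entry V E lt v \<noteq> entry V E lt w"
      using every_vertex_enters[OF assms] same_entry_imp_eq by metis
    then show "(v, w) \<in> algorithmic_traversal V E lt \<or> (w, v) \<in> algorithmic_traversal V E lt"
      using vw by (auto simp: algorithmic_traversal_def neq_iff)
  qed
  moreover have "trans (algorithmic_traversal V E lt)" "irrefl (algorithmic_traversal V E lt)"
    by (auto simp: algorithmic_traversal_def trans_def irrefl_def)
  ultimately show ?thesis
    by (auto simp: strict_well_order_on_def strict_linear_order_on_def algorithmic_traversal_def)
qed

section \<open>Searching the tree of least neighbors\<close>

lemma traversal_least_neighbor_props: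
  assumes G: "wellordered_connected_graph V E lt" and p: "traversal_least_neighbor V E lt v = Some u"
  shows traversal_least_neighbor_edge: "(v, u) \<in> E"
    and traversal_least_neighbor_entry: "(v, w) \<in> E \<Longrightarrow> entry V E lt u \<le> entry V E lt w"
proof -
  let ?v0 = "least_in lt V" and ?N = "{w. (v, w) \<in> E}"
  have wo: "strict_well_order_on V lt" and EV: "E \<subseteq> V \<times> V"
    and conn: "\<forall>v\<in>V. \<forall>w\<in>V. (v, w) \<in> E\<^sup>*"
    using G by (auto simp: wellordered_connected_graph_def connected_graph_def)
  have v: "v \<in> V" "v \<noteq> ?v0" and u: "u = least_in (algorithmic_traversal V E lt) ?N"
    using p by (auto simp: traversal_least_neighbor_def split: if_splits)
  have "?v0 \<in> V"
    using least_in_mem[OF wo] v by blast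
  then have "(v, ?v0) \<in> E\<^sup>*"
    using conn v by blast
  then have ne: "?N \<noteq> {}"
    using v(2) by (auto elim: converse_rtranclE)
  have sub: "?N \<subseteq> V"
    using EV by blast
  note wo' = algorithmic_traversal_well_order[OF G]
  show "(v, u) \<in> E"
    using least_in_mem[OF wo' sub ne] u by simp
  show "entry V E lt u \<le> entry V E lt w" if "(v, w) \<in> E"
    using least_in_less[OF wo' sub ne, of w] u that
    by (cases "w = u") (auto simp: algorithmic_traversal_def)
qed

lemma traversal_edges_subset:
  assumes G: "wellordered_connected_graph V E lt"
  shows "traversal_edges V E lt \<subseteq> E"
proof -
  have "sym E"
    using G by (simp add: wellordered_connected_graph_def connected_graph_def)
  then show ?thesis
    using traversal_least_neighbor_edge[OF G]
    by (auto simp: traversal_edges_def Map.graph_def dest: symD)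
qed

lemma frontier_traversal_edges:
  assumes G: "wellordered_connected_graph V E lt" and ge1: "osuc 0 \<le> \<beta>"
  defines "S \<equiv> stage V E lt \<beta>"
  shows "{v \<in> V - S. \<exists>w\<in>S. (w, v) \<in> traversal_edges V E lt} = {v \<in> V - S. \<exists>w\<in>S. (w, v) \<in> E}"
proof -
  have "\<exists>u\<in>S. (u, v) \<in> traversal_edges V E lt"
    if v: "v \<in> V" "v \<notin> S" and w: "w \<in> S" and wv: "(w, v) \<in> E" for v w
  proof -
    have "sym E"
      using G by (simp add: wellordered_connected_graph_def connected_graph_def)
    then have vw: "(v, w) \<in> E"
      using wv by (rule symD)
    \<comment> \<open>The least vertex lies in every nonempty stage, so \<open>v\<close> is not minimal and \<open>p\<^sup>\<star> v\<close> exists.\<close>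
    have "least_in lt V \<in> S"
      using stage_mono[OF ge1, of V E lt] by (simp add: stage_one S_def)
    then have "v \<noteq> least_in lt V"
      using v by blast
    then obtain u where u: "traversal_least_neighbor V E lt v = Some u"
      using v by (simp add: traversal_least_neighbor_def)
    have "u \<in> V"
      using traversal_least_neighbor_edge[OF G u] G
      by (auto simp: wellordered_connected_graph_def connected_graph_def)
    then obtain \<gamma> where \<gamma>: "u \<in> stage V E lt \<gamma>"
      using every_vertex_enters[OF G] by blast
    have "entry V E lt u \<le> entry V E lt w"
      using traversal_least_neighbor_entry[OF G u vw] .
    also have "\<dots> \<le> \<beta>"
      using w by (auto simp: S_def intro: Least_le)
    finally have "u \<in> S"
      unfolding S_def by (rule mem_stage_iff_entry_le[OF \<gamma>, THEN iffD2])
    with u show ?thesis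
      by (auto simp: traversal_edges_def Map.graph_def)
  qed
  then show ?thesis
    using traversal_edges_subset[OF G] by blast
qed

lemma stage_traversal_edges:
  assumes G: "wellordered_connected_graph V E lt"
  shows "stage V (traversal_edges V E lt) lt \<alpha> = stage V E lt \<alpha>"
proof (induction \<alpha> rule: less_induct)
  case (less \<alpha>)
  consider "\<alpha> = 0" | "\<alpha> = osuc 0" | \<beta> where "\<alpha> = osuc \<beta>" "osuc 0 \<le> \<beta>"
    | "\<alpha> \<noteq> 0" "\<And>\<beta>. \<alpha> \<noteq> osuc \<beta>"
    by (metis one_le_ordinal_iff)
  then show ?case
  proof cases
    case (3 \<beta>)
    then show ?thesis
      using less.IH[of \<beta>] frontier_traversal_edges[OF G, of \<beta>]
      by (simp add: stage_osuc search_step_def)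
  next
    case 4
    then show ?thesis
      using less.IH by (simp add: stage_limit)
  qed (simp_all add: stage_zero stage_one)
qed

theorem theorem2p9:
  fixes V :: "'a set" and E lt :: "'a rel"
  assumes "wellordered_connected_graph V E lt"
    and "V \<noteq> {}"
  shows "algorithmic_traversal V (traversal_edges V E lt) lt = algorithmic_traversal V E lt"
  using stage_traversal_edges[OF assms(1)] by (simp add: algorithmic_traversal_def)

end
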